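(* For integers $n\ge 0$ let $G(n)=\sum_{k=0}^{n}\frac{1}{16^k}\binom{2k}{k}^2$, let $c_0=\frac{1}{\pi}(\gamma+4\ln 2)$ with $\gamma$ the Euler–Mascheroni constant, and with $x=(n+\tfrac34)^2$ let $$\mathrm{MC}_2(n)=\frac{1}{\pi}\,\cfrac{\kappa_1}{x+\lambda_1+\cfrac{\kappa_2}{x+\lambda_2}},$$ where $\kappa_1=\frac{11}{192}$, $\lambda_1=\frac{1541}{7040}$, $\kappa_2=-\frac{89684299}{1040793600}$, $\lambda_2=\frac{815593360691}{631377464960}$. Then for all integers $n\ge 0$, $$\frac{C_2}{(n+\frac74)^{10}}<G(n)-\frac{1}{\pi}\ln\left(n+\frac34\right)-c_0-\mathrm{MC}_2(n)<\frac{C_2}{(n+\frac34)^{10}},$$ where $C_2=\frac{31675858150027835699}{5605686531912433139712\pi}$.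
   Context: $\gamma=\lim_{n\to\infty}\left(\sum_{m=1}^n\frac1m-\ln n\right)$ is the Euler–Mascheroni constant. *)

theory Defs
  imports "HOL-Analysis.Analysis"
begin

definition G :: "nat \<Rightarrow> real" where
  "G n = (\<Sum>k=0..n. 1 / 16 ^ k * (real ((2 * k) choose k))\<^sup>2)"

definition c0 :: real where
  "c0 = 1 / pi * (euler_mascheroni + 4 * ln 2)"

definition kappa1 :: real where "kappa1 = 11 / 192"
definition lambda1 :: real where "lambda1 = 1541 / 7040"
definition kappa2 :: real where "kappa2 = - (89684299 / 1040793600)"
definition lambda2 :: real where "lambda2 = 815593360691 / 631377464960"

definition MC2 :: "nat \<Rightarrow> real" where
  "MC2 n = (let x = (real n + 3 / 4)\<^sup>2
            in 1 / pi * (kappa1 / (x + lambda1 + kappa2 / (x + lambda2))))"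

definition C2 :: real where
  "C2 = 31675858150027835699 / (5605686531912433139712 * pi)"

end

theory Submission
  imports Defs "HOL-Real_Asymp.Real_Asymp" "HOL-Computational_Algebra.Polynomial"
begin

text \<open>
  Write \<open>a k = binomial (2 k) k / 4 ^ k\<close>, so that \<open>G n\<close> is the sum of the \<open>(a k)\<^sup>2\<close> for \<open>k \<le> n\<close>.

  The constant: \<open>pi * a k\<close> and \<open>2 / ((2 k + 1) * a k)\<close> are the Beta integrals of
  \<open>t powr (k - 1/2)\<close> and \<open>t ^ k\<close> against \<open>(1 - t) powr (-1/2)\<close>. Since the \<open>a k * t ^ k\<close> sum to
  \<open>(1 - t) powr (-1/2)\<close>, the series with terms \<open>pi * (a k)\<^sup>2 - 2 / (2 k + 1)\<close> has the sum
  \<open>\<integral> dt / (sqrt t * (1 + sqrt t)) = 2 ln 2\<close> over the unit interval, and what is left are harmonic numbers.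

  The inequalities: the error tends to 0, so it suffices to bound its first difference by the
  differences of \<open>C2 / y ^ 10\<close> (from above) and of \<open>C2 / (y\<^sup>2 + 2) ^ 5\<close> (from below), where
  \<open>y = n + 3/4\<close>. In the first difference, \<open>pi * (a (n + 1))\<^sup>2\<close> lies between two convergents of
  Ramanujan's continued fraction for the squared quotient of Gamma values, and the logarithm is
  enclosed by its Taylor series. In terms of \<open>p = 2 n + 5/2\<close> every
  function involved is odd, so all that remains is the positivity for \<open>s \<ge> 6\<close> of two polynomials in
  \<open>s = p\<^sup>2\<close>, and all their coefficients at \<open>s = 6\<close> are nonnegative.
\<close>

section \<open>The constant term\<close>

definition central_ratio :: "nat \<Rightarrow> real" where
  "central_ratio k = real ((2 * k) choose k) / 4 ^ k"

lemma central_ratio_0 [simp]: "central_ratio 0 = 1"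
  by (simp add: central_ratio_def)

lemma central_ratio_Suc:
  "central_ratio (Suc k) = central_ratio k * (2 * real k + 1) / (2 * real k + 2)"
proof -
  have choose: "real ((2 * j) choose j) = fact (2 * j) / (fact j * fact j)" for j
    using binomial_fact[of j "2 * j", where 'a = real] by simp
  have "fact (2 * Suc k) = (2 * real k + 2) * ((2 * real k + 1) * fact (2 * k))"
    by (simp add: algebra_simps)
  then show ?thesis
    unfolding central_ratio_def choose by (simp add: divide_simps) (simp add: algebra_simps)
qed

lemma central_ratio_pos: "central_ratio k > 0"
  by (simp add: central_ratio_def)

lemma G_eq_sum_central_ratio: "G n = (\<Sum>k\<le>n. central_ratio k ^ 2)"
proof -
  have "(16::real) ^ k = (4 ^ k) ^ 2" for k
    using power_mult[of "4::real" 2 k] by (simp add: power_even_eq)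
  then show ?thesis
    by (simp add: G_def central_ratio_def power_divide atMost_atLeast0)
qed

lemma gbinomial_neg_half: "((-1/2 :: real) gchoose k) = (-1) ^ k * central_ratio k"
proof (induction k)
  case (Suc k)
  show ?case
    using gbinomial_mult_1[of "-1/2 :: real" k] Suc
    by (simp add: central_ratio_Suc field_simps)
qed simp

lemma central_ratio_sums:
  assumes "\<bar>t\<bar> < 1"
  shows "(\<lambda>k. central_ratio k * t ^ k) sums ((1 - t) powr (-1/2))"
proof -
  have "(\<lambda>k. ((-1/2) gchoose k) * (- t) ^ k) sums ((1 + - t) powr (-1/2))"
    by (rule gen_binomial_real) (use assms in auto)
  also have "(\<lambda>k. ((-1/2) gchoose k) * (- t) ^ k) = (\<lambda>k. central_ratio k * t ^ k)"
  proof
    fix k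
    have "(-1/2 gchoose k) * (- t) ^ k = ((-1) ^ k * (-1) ^ k) * (central_ratio k * t ^ k)"
      unfolding gbinomial_neg_half power_minus[of t] by (simp only: mult_ac)
    also have "(-1 :: real) ^ k * (-1) ^ k = 1"
      by (simp flip: power_mult_distrib)
    finally show "(-1/2 gchoose k) * (- t) ^ k = central_ratio k * t ^ k"
      by simp
  qed
  finally show ?thesis by simp
qed

text \<open>\<open>Beta (x + 1) y = x / (x + y) * Beta x y\<close> reproduces the recurrence of
  \<open>central_ratio\<close>, started at \<open>Gamma (1/2) ^ 2 = pi\<close>.\<close>

lemma Beta_half_half: "Beta (real k + 1/2) (1/2) = pi * central_ratio k"
proof (induction k)
  case 0
  show ?case by (simp add: Beta_def Gamma_one_half_real)
next
  case (Suc k)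
  have "real k + 1/2 \<notin> \<int>\<^sub>\<le>\<^sub>0"
    using nonpos_Ints_nonpos[of "real k + 1/2"] by auto
  from Beta_plus1_left[OF this, of "1/2"] Suc show ?case
    by (simp add: central_ratio_Suc field_simps)
qed

lemma Beta_Suc_half: "Beta (real k + 1) (1/2) = 2 / ((2 * real k + 1) * central_ratio k)"
proof (induction k)
  case 0
  have "(1/2 :: real) \<notin> \<int>\<^sub>\<le>\<^sub>0"
    using nonpos_Ints_nonpos[of "1/2 :: real"] by auto
  from Gamma_plus1[OF this] have Gamma: "Gamma (3/2 :: real) = sqrt pi / 2"
    by (simp add: Gamma_one_half_real)
  show ?case by (simp add: Beta_def Gamma_one_half_real Gamma)
next
  case (Suc k)
  have "real k + 1 \<notin> \<int>\<^sub>\<le>\<^sub>0"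
    using nonpos_Ints_nonpos[of "real k + 1"] by auto
  from Beta_plus1_left[OF this, of "1/2"]
  have "Beta (real (Suc k) + 1) (1/2) = (real k + 1) * Beta (real k + 1) (1/2) / (real k + 3/2)"
    by (simp add: field_simps)
  also have "\<dots> = 2 / ((2 * real (Suc k) + 1) * central_ratio (Suc k))"
    unfolding Suc central_ratio_Suc using central_ratio_pos[of k]
    by (simp add: divide_simps)
  finally show ?case .
qed

text \<open>The antiderivative \<open>2 * ln (1 + sqrt t)\<close> is continuous on the closed
  interval but differentiable only away from 0.\<close>

lemma integral_inverse_sqrt:
  "((\<lambda>t. 1 / (sqrt t * (1 + sqrt t))) has_integral 2 * ln 2) {0<..<1::real}"
proof -
  have "((\<lambda>t. 1 / (sqrt t * (1 + sqrt t))) has_integral (2 * ln (1 + sqrt 1) - 2 * ln (1 + sqrt 0))) {0..1::real}"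
  proof (rule fundamental_theorem_of_calculus_interior)
    show "continuous_on {0..1} (\<lambda>t::real. 2 * ln (1 + sqrt t))"
      by (intro continuous_intros) (auto simp: add_nonneg_eq_0_iff)
    fix t :: real assume "t \<in> {0<..<1}"
    then have t: "t > 0" by auto
    then have "1 + sqrt t > 0" by (simp add: add_pos_nonneg)
    moreover have "sqrt t * (sqrt t * 2) = t * 2" using t by (simp flip: mult.assoc)
    ultimately show "((\<lambda>t. 2 * ln (1 + sqrt t)) has_vector_derivative 1 / (sqrt t * (1 + sqrt t))) (at t)"
      unfolding has_real_derivative_iff_has_vector_derivative[symmetric]
      using t by (auto intro!: derivative_eq_intros simp: divide_simps)
  qed auto
  then show ?thesis by (simp add: has_integral_Icc_iff_Ioo)
qed

lemma sum_squares_tendsto: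
  "(\<lambda>n. \<Sum>k<n. pi * central_ratio k ^ 2 - 2 / (2 * real k + 1)) \<longlonglongrightarrow> 2 * ln 2"
proof -
  \<comment> \<open>\<open>h k\<close> is the integrand of the difference of the two Beta integrals.
    Separately the two series diverge; paired, each term is nonnegative on the unit interval, as
    monotone convergence requires.\<close>
  define h where "h k t = central_ratio k * ((t powr (real k + 1/2 - 1) - t powr (real k + 1 - 1)) * (1 - t) powr (1/2 - 1))" for k t
  define f where "f n t = (\<Sum>k<n. h k t)" for n t
  define g where "g t = 1 / (sqrt t * (1 + sqrt t))" for t :: real
  define I where "I n = (\<Sum>k<n. pi * central_ratio k ^ 2 - 2 / (2 * real k + 1))" for n
  have h_int: "(h k has_integral (pi * central_ratio k ^ 2 - 2 / (2 * real k + 1))) {0<..<1}" for k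
  proof -
    have "(h k has_integral (central_ratio k * (Beta (real k + 1/2) (1/2) - Beta (real k + 1) (1/2)))) {0<..<1}"
      unfolding h_def left_diff_distrib
      by (intro has_integral_mult_right has_integral_diff)
         (use has_integral_Beta_real[of "real k + 1/2" "1/2"] has_integral_Beta_real[of "real k + 1" "1/2"]
          in \<open>simp_all add: has_integral_Icc_iff_Ioo\<close>)
    also have "central_ratio k * (Beta (real k + 1/2) (1/2) - Beta (real k + 1) (1/2)) =
        pi * central_ratio k ^ 2 - 2 / (2 * real k + 1)"
      using central_ratio_pos[of k]
      unfolding Beta_half_half Beta_Suc_half by (simp add: power2_eq_square right_diff_distrib)
    finally show ?thesis .
  qed
  have f_int: "(f n has_integral I n) {0<..<1}" for n
    unfolding f_def I_def by (intro has_integral_sum h_int) auto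
  have h_nonneg: "h k t \<ge> 0" if "t \<in> {0<..<1}" for k t
    unfolding h_def using that central_ratio_pos[of k]
    by (intro mult_nonneg_nonneg) (auto intro!: powr_mono')
  have f_sums: "(\<lambda>k. h k t) sums g t" if "t \<in> {0<..<1}" for t
  proof -
    have t: "0 < t" "t < 1" using that by auto
    have r: "0 < sqrt t" "sqrt t * sqrt t = t" "sqrt t < 1" using t by auto
    have "(\<lambda>k. (1 / sqrt t - 1) * (1 - t) powr (-1/2) * (central_ratio k * t ^ k)) sums
            ((1 / sqrt t - 1) * (1 - t) powr (-1/2) * (1 - t) powr (-1/2))"
      by (intro sums_mult central_ratio_sums) (use t in auto)
    also have "(\<lambda>k. (1 / sqrt t - 1) * (1 - t) powr (-1/2) * (central_ratio k * t ^ k)) = (\<lambda>k. h k t)"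
    proof
      fix k
      have "t powr (real k + 1/2 - 1) = t ^ k / sqrt t"
        using t powr_diff[of t "real k" "1/2"] by (simp add: powr_realpow powr_half_sqrt)
      then show "(1 / sqrt t - 1) * (1 - t) powr (-1/2) * (central_ratio k * t ^ k) = h k t"
        using t by (simp add: h_def powr_realpow field_simps)
    qed
    also have "(1 / sqrt t - 1) * (1 - t) powr (-1/2) * (1 - t) powr (-1/2) = (1 / sqrt t - 1) / (1 - t)"
      using t by (simp add: powr_minus_divide flip: powr_add)
    \<comment> \<open>The factor \<open>1 - sqrt t\<close> cancels the singularity at 1.\<close>
    also have "1 - t = (1 - sqrt t) * (1 + sqrt t)"
      using r by (simp add: algebra_simps)
    also have "(1 / sqrt t - 1) / \<dots> = g t"
      using r by (simp add: g_def divide_simps)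
    finally show ?thesis .
  qed
  have f_le: "f n t \<le> g t" if "t \<in> {0<..<1}" for n t
    unfolding f_def sums_unique[OF f_sums[OF that]]
    by (rule sum_le_suminf) (use that h_nonneg f_sums in \<open>auto simp: sums_iff\<close>)
  have g_int: "(g has_integral 2 * ln 2) {0<..<1}"
    unfolding g_def by (rule integral_inverse_sqrt)
  have I_eq: "integral {0<..<1} (f n) = I n" for n
    using f_int by (rule integral_unique)
  have "I n \<le> 2 * ln 2" for n
    by (rule has_integral_le[OF f_int g_int f_le])
  moreover have "0 \<le> I n" for n
    using f_int by (rule has_integral_nonneg) (auto simp: f_def intro!: sum_nonneg h_nonneg)
  ultimately have "bounded (range (\<lambda>n. integral {0<..<1} (f n)))"
    unfolding I_eq by (intro boundedI[of _ "2 * ln 2"]) auto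
  then have "(\<lambda>n. integral {0<..<1} (f n)) \<longlonglongrightarrow> integral {0<..<1} g"
    using f_int f_sums h_nonneg
    by (intro monotone_convergence_increasing[THEN conjunct2])
       (auto simp: f_def sums_def)
  then show ?thesis
    unfolding I_eq I_def using g_int by (simp add: integral_unique)
qed

text \<open>Removing the even terms \<open>2 / (2 * j) = 1 / j\<close> from
  \<open>2 * harm (2 * n)\<close> leaves the odd ones.\<close>

lemma sum_odd_reciprocals: "(\<Sum>k<n. 2 / (2 * real k + 1)) = 2 * harm (2 * n) - harm n"
proof (induction n)
  case (Suc n)
  have "harm (2 * Suc n) = harm (2 * n) + 1 / (2 * real n + 1) + 1 / (2 * real n + 2)"
    by (simp add: harm_Suc inverse_eq_divide add_ac)
  moreover have "2 / (2 * real n + 2) = 1 / (real n + 1)"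
    by (simp add: divide_simps)
  ultimately show ?case
    using Suc by (simp add: harm_Suc inverse_eq_divide add_ac)
qed (simp add: harm_def)

lemma sum_odd_reciprocals_tendsto:
  "(\<lambda>n. (\<Sum>k<n. 2 / (2 * real k + 1)) - ln (real n)) \<longlonglongrightarrow> euler_mascheroni + 2 * ln 2"
proof -
  have "(\<lambda>n. 2 * (harm (2 * n) - ln (real (2 * n))) - (harm n - ln (real n)) + 2 * ln 2)
          \<longlonglongrightarrow> 2 * euler_mascheroni - euler_mascheroni + 2 * ln 2"
    by (intro tendsto_intros euler_mascheroni_LIMSEQ
          filterlim_compose[OF euler_mascheroni_LIMSEQ]) real_asymp
  moreover have "eventually (\<lambda>n. 2 * (harm (2 * n) - ln (real (2 * n))) - (harm n - ln (real n)) + 2 * ln 2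
      = (\<Sum>k<n. 2 / (2 * real k + 1)) - ln (real n)) sequentially"
    using eventually_gt_at_top[of 0]
    by eventually_elim (simp add: sum_odd_reciprocals ln_mult)
  ultimately have "(\<lambda>n. (\<Sum>k<n. 2 / (2 * real k + 1)) - ln (real n))
      \<longlonglongrightarrow> 2 * euler_mascheroni - euler_mascheroni + 2 * ln 2"
    by (rule Lim_transform_eventually)
  then show ?thesis by simp
qed

lemma G_tendsto: "(\<lambda>n. G n - 1 / pi * ln (real n + 3 / 4)) \<longlonglongrightarrow> c0"
proof -
  let ?S = "\<lambda>n. (\<Sum>k<Suc n. pi * central_ratio k ^ 2 - 2 / (2 * real k + 1))"
  let ?T = "\<lambda>n. (\<Sum>k<Suc n. 2 / (2 * real k + 1)) - ln (real (Suc n))"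
  have "(\<lambda>n. 1 / pi * (?S n + ?T n + (ln (real (Suc n)) - ln (real n + 3 / 4))))
          \<longlonglongrightarrow> 1 / pi * (2 * ln 2 + (euler_mascheroni + 2 * ln 2) + 0)"
    by (intro tendsto_mult tendsto_const tendsto_add LIMSEQ_Suc[OF sum_squares_tendsto]
          LIMSEQ_Suc[OF sum_odd_reciprocals_tendsto]) real_asymp
  moreover have "1 / pi * (?S n + ?T n + (ln (real (Suc n)) - ln (real n + 3 / 4)))
      = G n - 1 / pi * ln (real n + 3 / 4)" for n
  proof -
    have "?S n + ?T n = pi * G n - ln (real (Suc n))"
      by (simp only: sum_subtractf G_eq_sum_central_ratio lessThan_Suc_atMost sum_distrib_left)
    then show ?thesis by (simp only:) (simp add: right_diff_distrib)
  qed
  ultimately have "(\<lambda>n. G n - 1 / pi * ln (real n + 3 / 4))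
      \<longlonglongrightarrow> 1 / pi * (2 * ln 2 + (euler_mascheroni + 2 * ln 2) + 0)"
    by (simp only:)
  also have "1 / pi * (2 * ln 2 + (euler_mascheroni + 2 * ln 2) + 0) = c0"
    by (simp add: c0_def)
  finally show ?thesis .
qed

text \<open>Wallis' product in terms of \<open>central_ratio\<close>. It fixes the limit 1 of the
  quotients with the continued fraction convergents.\<close>

lemma central_ratio_wallis: "(\<lambda>n. (2 * real n + 1) * central_ratio n ^ 2) \<longlonglongrightarrow> 2 / pi"
proof -
  have eq: "(\<Prod>k=1..n. (4 * real k ^ 2) / (4 * real k ^ 2 - 1)) = inverse ((2 * real n + 1) * central_ratio n ^ 2)" for n
  proof (induction n)
    case (Suc n)
    have "4 * (1 + real n)\<^sup>2 - 1 = (2 * real n + 1) * (2 * real n + 3)"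
      by (simp add: power2_eq_square algebra_simps)
    note factor = this
    have "(\<Prod>k=1..Suc n. (4 * real k ^ 2) / (4 * real k ^ 2 - 1)) =
        (4 * (1 + real n)\<^sup>2) / (4 * (1 + real n)\<^sup>2 - 1) * inverse ((2 * real n + 1) * central_ratio n ^ 2)"
      using Suc by simp
    also have "\<dots> = inverse ((2 * real (Suc n) + 1) * central_ratio (Suc n) ^ 2)"
      unfolding factor central_ratio_Suc using central_ratio_pos[of n]
      by (simp add: power2_eq_square divide_simps) (simp add: algebra_simps)
    finally show ?case .
  qed simp
  have "(\<lambda>n. inverse (inverse ((2 * real n + 1) * central_ratio n ^ 2))) \<longlonglongrightarrow> inverse (pi / 2)"
    by (intro tendsto_inverse) (use wallis[unfolded eq] in auto)
  then show ?thesis by (simp add: field_simps)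
qed

section \<open>Enclosures of the summand and the logarithm\<close>

text \<open>\<open>log_num s / (3465 * s^5)\<close> sums the first six terms of \<open>p * ln ((p +
  1) / (p - 1)) = 2 * (1 + 1 / (3 * s) + 1 / (5 * s^2) + ...)\<close>, where \<open>s = p^2\<close>;
  3465 is the lcm of 1, 3, ..., 11.\<close>

definition log_num :: "'a::comm_ring_1 \<Rightarrow> 'a" where
  "log_num s = 2 * (3465 * s^5 + 1155 * s^4 + 693 * s^3 + 495 * s^2 + 385 * s + 315)"

text \<open>
  \<open>cf5\<close> and \<open>cf6\<close> are successive convergents of
  \<open>(Gamma (p/2 + 1/4) / Gamma (p/2 + 3/4))\<^sup>2 = 4 / (2p + 1\<^sup>2 / (4p + 3\<^sup>2 / (4p + 5\<^sup>2 / (4p + \<dots>))))\<close>,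
  namely \<open>p * cf5_num s / cf5_den s\<close> and \<open>cf6_num s / (p * cf6_den s)\<close> with \<open>s = p\<^sup>2\<close>.
  The definitions are polymorphic so that they can be evaluated
  both at real numbers and at real polynomials.
\<close>

definition cf5_num :: "'a::comm_ring_1 \<Rightarrow> 'a" where
  "cf5_num s = 51120 + 41984 * s + 4096 * s^2"

definition cf5_den :: "'a::comm_ring_1 \<Rightarrow> 'a" where
  "cf5_den s = 2025 + 28040 * s + 21248 * s^2 + 2048 * s^3"

definition cf6_num :: "'a::comm_ring_1 \<Rightarrow> 'a" where
  "cf6_num s = 106722 + 423616 * s + 145920 * s^2 + 8192 * s^3"

definition cf6_den :: "'a::comm_ring_1 \<Rightarrow> 'a" where
  "cf6_den s = 75319 + 220640 * s + 73472 * s^2 + 4096 * s^3"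

text \<open>
  \<open>s * mc_num s / mc_den s\<close> is \<open>p\<close> times the decrease of \<open>pi * MC2\<close> from \<open>(p - 1) / 2\<close> to \<open>(p + 1) / 2\<close>.
\<close>

definition mc_num :: "'a::comm_ring_1 \<Rightarrow> 'a" where
  "mc_num s = 167963805809751762234016768 + 35518440858984633355481088 * s
     + 4261797307572324079042560 * s^2"

definition mc_den :: "'a::comm_ring_1 \<Rightarrow> 'a" where
  "mc_den s = 5 * (96514883495645369798874961 - 12417190098822261965190720 * s
        + 34143102332327085641564160 * s^2 + 7518072978235075631284224 * s^3 + 929846685288507071791104 * s^4)"

definition C2_num :: "'a::comm_ring_1" where "C2_num = 31675858150027835699"

definition C2_den :: "'a::comm_ring_1" where "C2_den = 5605686531912433139712"

lemmas num_defs = log_num_def cf5_num_def cf5_den_def cf6_num_def cf6_den_def mc_num_def mc_den_def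
  C2_num_def C2_den_def Let_def

lemmas poly_eval = poly_add poly_mult poly_diff poly_power poly_numeral poly_1

text \<open>The convergent nearly satisfies the recurrence of
  \<open>pi * central_ratio k ^ 2\<close>, in which \<open>p\<close> grows by 2. The defect
  \<open>96 * (1 * 3 * 5 * 7 * 9 * 11)^2\<close> is positive, which makes the quotient
  monotone.\<close>

lemma cf5_step:
  fixes p :: real
  shows "(2 * p + 3)^2 * ((p + 2) * cf5_num ((p + 2)^2)) * cf5_den (p^2)
       - (2 * p + 1)^2 * (p * cf5_num (p^2)) * cf5_den ((p + 2)^2) = 10373378400"
proof -
  \<comment> \<open>The identity is checked on polynomials in the indeterminate \<open>X\<close>,
    then evaluated at \<open>p\<close>.\<close>
  define X :: "real poly" where "X = [:0, 1:]"
  have "(2 * X + 3)^2 * ((X + 2) * cf5_num ((X + 2)^2)) * cf5_den (X^2)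
       - (2 * X + 1)^2 * (X * cf5_num (X^2)) * cf5_den ((X + 2)^2) = 10373378400"
    unfolding X_def num_defs by (simp add: eval_nat_numeral numeral_poly one_pCons)
  from arg_cong[OF this, of "\<lambda>q. poly q p"]
  show ?thesis
    unfolding num_defs poly_eval by (simp add: X_def)
qed

text \<open>Here the convergent falls faster than \<open>pi * central_ratio k ^ 2\<close>; the
  defect is \<open>28 * (1 * 3 * 5 * 7 * 9 * 11 * 13)^2\<close>.\<close>

lemma cf6_step:
  fixes p :: real
  shows "(2 * p + 1)^2 * cf6_num (p^2) * ((p + 2) * cf6_den ((p + 2)^2))
       - (2 * p + 3)^2 * cf6_num ((p + 2)^2) * (p * cf6_den (p^2)) = 511321110300"
proof -
  define X :: "real poly" where "X = [:0, 1:]"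
  have "(2 * X + 1)^2 * cf6_num (X^2) * ((X + 2) * cf6_den ((X + 2)^2))
       - (2 * X + 3)^2 * cf6_num ((X + 2)^2) * (X * cf6_den (X^2)) = 511321110300"
    unfolding X_def num_defs by (simp add: eval_nat_numeral numeral_poly one_pCons)
  from arg_cong[OF this, of "\<lambda>q. poly q p"]
  show ?thesis
    unfolding num_defs poly_eval by (simp add: X_def)
qed

lemma LIMSEQ_strict_decreasing_imp_less:
  fixes f :: "nat \<Rightarrow> real"
  assumes "\<And>k. f (Suc k) < f k" "f \<longlonglongrightarrow> l"
  shows "l < f k"
proof -
  have "decseq f"
    using assms(1) by (intro decseq_SucI less_imp_le)
  from decseq_ge[OF this assms(2), of "Suc k"] assms(1)[of k] show ?thesis
    by simp
qed

lemma ratio_decreasing_to_1_imp_less: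
  fixes f V :: "nat \<Rightarrow> real"
  assumes V: "\<And>k. V k > 0"
    and step: "\<And>k. f (Suc k) * V k < f k * V (Suc k)"
    and lim: "(\<lambda>k. f k / V k) \<longlonglongrightarrow> 1"
  shows "V k < f k"
proof -
  have "f (Suc j) / V (Suc j) < f j / V j" for j
    using step[of j] V[of j] V[of "Suc j"] by (simp add: divide_simps mult.commute)
  from LIMSEQ_strict_decreasing_imp_less[OF this lim, of k] show ?thesis
    using V[of k] by simp
qed

lemma cf_pos:
  fixes s :: real
  assumes "s > 0"
  shows "cf5_num s > 0" "cf5_den s > 0" "cf6_num s > 0" "cf6_den s > 0"
  using assms by (simp_all add: num_defs add_pos_pos)

text \<open>With \<open>p = 2 * k + 1/2\<close> the quantity enclosed is
  \<open>(Gamma (k + 1/2) / Gamma (k + 1)) ^ 2\<close>. Its quotient by the lower convergent and the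
  quotient of the upper convergent by it both decrease strictly to 1.\<close>

lemma central_ratio_bounds:
  fixes k :: nat
  defines "p \<equiv> 2 * real k + 1/2"
  shows central_ratio_gt: "p * cf5_num (p^2) / cf5_den (p^2) < pi * central_ratio k ^ 2"
    and central_ratio_less: "pi * central_ratio k ^ 2 < cf6_num (p^2) / (p * cf6_den (p^2))"
proof -
  define P where "P k = 2 * real k + 1/2" for k
  have P: "P k > 0" "P k ^ 2 > 0" "P (Suc k) = P k + 2" for k
    by (simp_all add: P_def)
  define L where "L k = P k * cf5_num (P k^2) / cf5_den (P k^2)" for k
  define U where "U k = cf6_num (P k^2) / (P k * cf6_den (P k^2))" for k
  define w where "w k = pi * central_ratio k ^ 2" for k
  have w: "w k > 0" for k
    using central_ratio_pos[of k] by (simp add: w_def)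
  have w_Suc: "w (Suc k) = w k * (2 * P k + 1)^2 / (2 * P k + 3)^2" for k
  proof -
    have P2: "2 * P k + 1 = 2 * (2 * real k + 1)" "2 * P k + 3 = 2 * (2 * real k + 2)"
      by (simp_all add: P_def)
    show ?thesis
      unfolding P2 w_def central_ratio_Suc power_mult_distrib power_divide by simp
  qed
  have L: "L k > 0" and U: "U k > 0" for k
    using P(1,2)[of k] cf_pos[of "P k ^ 2"] by (simp_all add: L_def U_def)
  have "w (Suc k) * L k < w k * L (Suc k)" for k
  proof -
    have "(2 * P k + 1)^2 * L k < (2 * P k + 3)^2 * L (Suc k)"
      unfolding L_def P(3) using cf5_step[of "P k"] cf_pos[of "P k ^ 2"] cf_pos[of "(P k + 2) ^ 2"] P(1)[of k] P(2)[of k]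
      by (simp add: divide_simps mult_ac)
    then show ?thesis
      unfolding w_Suc using w[of k] P(1)[of k] by (simp add: divide_simps mult_ac)
  qed
  moreover have "(\<lambda>k. w k / L k) \<longlonglongrightarrow> 1"
  proof -
    \<comment> \<open>\<open>L k\<close> behaves like \<open>2 / p\<close>; the factor
      \<open>2 * k + 1\<close> makes it comparable with Wallis' limit.\<close>
    have "(\<lambda>k. (2 * real k + 1) * L k) \<longlonglongrightarrow> 2"
      unfolding L_def P_def num_defs by real_asymp
    with central_ratio_wallis
    have "(\<lambda>k. pi * ((2 * real k + 1) * central_ratio k ^ 2) / ((2 * real k + 1) * L k)) \<longlonglongrightarrow> pi * (2 / pi) / 2"
      by (intro tendsto_intros) auto
    moreover have "pi * ((2 * real k + 1) * central_ratio k ^ 2) / ((2 * real k + 1) * L k) = w k / L k" for k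
      by (simp add: w_def)
    ultimately show ?thesis by simp
  qed
  ultimately have "L k < w k"
    by (rule ratio_decreasing_to_1_imp_less[OF L])
  then show "p * cf5_num (p^2) / cf5_den (p^2) < pi * central_ratio k ^ 2"
    by (simp add: L_def w_def P_def p_def)
  have "U (Suc k) * w k < U k * w (Suc k)" for k
  proof -
    have "(2 * P k + 3)^2 * U (Suc k) < (2 * P k + 1)^2 * U k"
      unfolding U_def P(3) using cf6_step[of "P k"] cf_pos[of "P k ^ 2"] cf_pos[of "(P k + 2) ^ 2"] P(1)[of k] P(2)[of k]
      by (simp add: divide_simps mult_ac)
    then show ?thesis
      unfolding w_Suc using w[of k] P(1)[of k] by (simp add: divide_simps mult_ac)
  qed
  moreover have "(\<lambda>k. U k / w k) \<longlonglongrightarrow> 1"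
  proof -
    have "(\<lambda>k. (2 * real k + 1) * U k) \<longlonglongrightarrow> 2"
      unfolding U_def P_def num_defs by real_asymp
    with central_ratio_wallis
    have "(\<lambda>k. ((2 * real k + 1) * U k) / (pi * ((2 * real k + 1) * central_ratio k ^ 2))) \<longlonglongrightarrow> 2 / (pi * (2 / pi))"
      by (intro tendsto_intros) auto
    moreover have "((2 * real k + 1) * U k) / (pi * ((2 * real k + 1) * central_ratio k ^ 2)) = U k / w k" for k
      by (simp add: w_def)
    ultimately show ?thesis by simp
  qed
  ultimately have "w k < U k"
    by (rule ratio_decreasing_to_1_imp_less[OF w])
  then show "pi * central_ratio k ^ 2 < cf6_num (p^2) / (p * cf6_den (p^2))"
    by (simp add: U_def w_def P_def p_def)
qed

text \<open>The series of \<open>2 * artanh (1 / p)\<close> is cut after six terms; the upper bound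
  adds a geometric majorant of the tail.\<close>

lemma ln_ratio_bounds:
  fixes p :: real
  assumes "1 < p"
  defines "s \<equiv> p^2"
  shows ln_ratio_ge: "log_num s / (3465 * s^5) \<le> p * ln ((p + 1) / (p - 1))"
    and ln_ratio_le: "p * ln ((p + 1) / (p - 1)) \<le>
      (13 * log_num s * (s - 1) + 6930) / (45045 * s^5 * (s - 1))"
proof -
  have s: "s > 1" using assms by (simp add: s_def one_less_power)
  have y: "((p + 1) / (p - 1) - 1) / ((p + 1) / (p - 1) + 1) = 1 / p"
    using assms by (simp add: divide_simps)
  have A: "(\<Sum>k<6. 2 * (1 / p)^(2*k+1) / real (2*k+1)) = log_num s / (3465 * s^5) / p"
    using assms by (simp add: log_num_def s_def eval_nat_numeral lessThan_Suc divide_simps)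
      (simp add: algebra_simps)
  have B: "2 * ((1 / p)^(2*6+1) / (1 - (1 / p)^2) / real (2*6+1)) = 2 / (13 * s^5 * (s - 1)) / p"
    using assms s by (simp add: s_def eval_nat_numeral divide_simps)
  from ln_approx_bounds[of "(p + 1) / (p - 1)" 6] assms
  have "ln ((p + 1) / (p - 1)) \<in> {log_num s / (3465 * s^5) / p ..
          log_num s / (3465 * s^5) / p + 2 / (13 * s^5 * (s - 1)) / p}"
    unfolding y A B by simp
  then have "log_num s / (3465 * s^5) / p \<le> ln ((p + 1) / (p - 1))"
    "ln ((p + 1) / (p - 1)) \<le> (log_num s / (3465 * s^5) + 2 / (13 * s^5 * (s - 1))) / p"
    by (simp_all add: add_divide_distrib)
  moreover have "log_num s / (3465 * s^5) + 2 / (13 * s^5 * (s - 1)) =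
      (13 * log_num s * (s - 1) + 6930) / (45045 * s^5 * (s - 1))"
    using s by (simp add: divide_simps)
  moreover have "a / p \<le> l \<longleftrightarrow> a \<le> p * l" "l \<le> a / p \<longleftrightarrow> p * l \<le> a" for a l
    using assms(1) by (simp_all add: field_simps)
  ultimately show "log_num s / (3465 * s^5) \<le> p * ln ((p + 1) / (p - 1))"
    "p * ln ((p + 1) / (p - 1)) \<le> (13 * log_num s * (s - 1) + 6930) / (45045 * s^5 * (s - 1))"
    by (simp_all only:)
qed

section \<open>The decrease of the approximation and of the error bounds\<close>

text \<open>\<open>M x\<close> is \<open>kappa1 * (x + lambda2) / q x\<close> with a quadratic
  \<open>q\<close>. Up to the factor \<open>x1 - x0 = p\<close>, numerator and denominator of the
  difference are symmetric in \<open>x0\<close> and \<open>x1\<close>, whose sum and product depend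
  on \<open>s\<close> only.\<close>

lemma mc_difference:
  fixes p :: real
  assumes "1 < p"
  defines "M \<equiv> \<lambda>x. kappa1 / (x + lambda1 + kappa2 / (x + lambda2))"
  shows "p * (M (((p - 1) / 2)^2) - M (((p + 1) / 2)^2)) = p^2 * mc_num (p^2) / mc_den (p^2)"
    and "mc_den (p^2) > 0"
proof -
  define a where "a = lambda1 + lambda2"
  define b where "b = lambda1 * lambda2 + kappa2"
  have ab: "a = 8670880595/5739795136" "b = 3033081530281/15428569325568"
    by (simp_all add: a_def b_def lambda1_def lambda2_def kappa2_def)
  define q where "q x = x^2 + a * x + b" for x
  have q: "q x > 0" and M: "M x = kappa1 * (x + lambda2) / q x" if "x \<ge> 0" for x
  proof -
    show "q x > 0"
      unfolding q_def using that by (intro add_nonneg_pos add_nonneg_nonneg) (simp_all add: ab)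
    moreover have l: "x + lambda2 > 0" using that by (simp add: lambda2_def)
    moreover have "x + lambda1 + kappa2 / (x + lambda2) = q x / (x + lambda2)"
      using l by (simp add: q_def a_def b_def divide_simps) (simp add: power2_eq_square algebra_simps)
    ultimately show "M x = kappa1 * (x + lambda2) / q x"
      by (simp add: M_def)
  qed
  define s where "s = p^2"
  define x0 where "x0 = ((p - 1) / 2)^2"
  define x1 where "x1 = ((p + 1) / 2)^2"
  have x: "x0 \<ge> 0" "x1 \<ge> 0" by (simp_all add: x0_def x1_def)
  have d: "x1 - x0 = p" and e1: "x0 + x1 = (s + 1) / 2"
    by (simp_all add: x0_def x1_def s_def power2_eq_square field_simps)
  have e2: "x0 * x1 = (s - 1)^2 / 16"
    unfolding x0_def x1_def power_mult_distrib[symmetric] s_def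
    by (simp add: power2_eq_square power_divide algebra_simps)
  \<comment> \<open>\<open>K\<close> clears the rational coefficients of numerator and denominator
    alike.\<close>
  define K :: real where "K = 1190203757169289051892613120"
  have "q x0 * q x1 = (x0 * x1)^2 + a * ((x0 + x1) * (x0 * x1)) + b * ((x0 + x1)^2 - 2 * (x0 * x1))
      + a^2 * (x0 * x1) + a * b * (x0 + x1) + b^2"
    by (simp add: q_def power2_eq_square algebra_simps)
  also have "\<dots> = mc_den s / K"
    unfolding e1 e2 ab mc_den_def K_def
    by (simp add: power2_eq_square power3_eq_cube power4_eq_xxxx field_simps)
  finally have Q: "mc_den s = K * (q x0 * q x1)"
    by (simp add: K_def)
  with q[OF x(1)] q[OF x(2)] show "mc_den (p^2) > 0"
    by (simp add: K_def s_def)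
  have "M x0 - M x1 = kappa1 * ((x0 + lambda2) * q x1 - (x1 + lambda2) * q x0) / (q x0 * q x1)"
    using q[OF x(1)] q[OF x(2)] unfolding M[OF x(1)] M[OF x(2)]
    by (simp add: divide_simps) (simp add: algebra_simps)
  also have "(x0 + lambda2) * q x1 - (x1 + lambda2) * q x0 =
      (x1 - x0) * (x0 * x1 + lambda2 * (x0 + x1) + a * lambda2 - b)"
    by (simp add: q_def power2_eq_square algebra_simps)
  also have "kappa1 * \<dots> = p * (mc_num s / K)"
    unfolding d e1 e2 ab mc_num_def K_def kappa1_def lambda2_def
    by (simp add: power2_eq_square field_simps)
  finally show "p * (M (((p - 1) / 2)^2) - M (((p + 1) / 2)^2)) = p^2 * mc_num (p^2) / mc_den (p^2)"
    unfolding x0_def[symmetric] x1_def[symmetric] s_def[symmetric] Q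
    by (simp add: s_def power2_eq_square K_def)
qed

lemma upper_power_difference:
  fixes p c :: real
  assumes "1 < p"
  defines "s \<equiv> p^2"
  shows "p * (c / ((p - 1) / 2)^10 - c / ((p + 1) / 2)^10)
       = 2048 * c * (10 * s + 120 * s^2 + 252 * s^3 + 120 * s^4 + 10 * s^5) / (s - 1)^10"
proof -
  have "p * ((p + 1)^10 - (p - 1)^10) = 2 * (10 * s + 120 * s^2 + 252 * s^3 + 120 * s^4 + 10 * s^5)"
    by (simp add: s_def eval_nat_numeral algebra_simps)
  moreover have "(s - 1)^10 = (p - 1)^10 * (p + 1)^10"
    unfolding power_mult_distrib[symmetric] s_def by (simp add: power2_eq_square algebra_simps)
  moreover have "p * (c / ((p - 1) / 2)^10 - c / ((p + 1) / 2)^10) =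
      1024 * c * (p * ((p + 1)^10 - (p - 1)^10)) / ((p - 1)^10 * (p + 1)^10)"
    using assms by (simp add: power_divide divide_simps) (simp add: algebra_simps)
  ultimately show ?thesis by simp
qed

text \<open>The difference of \<open>1 / (y^2 + 2)^5\<close> is odd in \<open>p\<close>, unlike that
  of the weaker target \<open>1 / (y + 1)^10\<close>; times \<open>p\<close> it becomes a function
  of \<open>s\<close>.\<close>

lemma lower_power_difference:
  fixes p c :: real
  defines "s \<equiv> p^2"
  defines "E1 \<equiv> 2 * (s + 9)" and "E2 \<equiv> s^2 + 14 * s + 81"
  shows "p * (c / (((p - 1) / 2)^2 + 2)^5 - c / (((p + 1) / 2)^2 + 2)^5)
       = 4096 * c * s * (E1^4 - 3 * E1^2 * E2 + E2^2) / E2^5"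
proof -
  define X where "X = (p - 1)^2 + 8"
  define Y where "Y = (p + 1)^2 + 8"
  have pos: "X > 0" "Y > 0" by (simp_all add: X_def Y_def add_nonneg_pos)
  have XY: "Y - X = 4 * p" "X + Y = E1" "X * Y = E2"
    by (simp_all add: X_def Y_def E1_def E2_def s_def power2_eq_square algebra_simps)
  have "Y^5 - X^5 = (Y - X) * ((X + Y)^4 - 3 * (X + Y)^2 * (X * Y) + (X * Y)^2)"
    by (simp add: eval_nat_numeral algebra_simps)
  then have diff: "Y^5 - X^5 = 4 * p * (E1^4 - 3 * E1^2 * E2 + E2^2)"
    unfolding XY .
  have quarter: "((p - 1) / 2)^2 + 2 = X / 4" "((p + 1) / 2)^2 + 2 = Y / 4"
    by (simp_all add: X_def Y_def power_divide)
  have "p * (c / (((p - 1) / 2)^2 + 2)^5 - c / (((p + 1) / 2)^2 + 2)^5) =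
      1024 * c * p * (Y^5 - X^5) / (X * Y)^5"
    unfolding quarter using pos
    by (simp add: power_divide power_mult_distrib divide_simps) (simp add: algebra_simps)
  also have "\<dots> = 4096 * c * s * (E1^4 - 3 * E1^2 * E2 + E2^2) / E2^5"
    unfolding diff XY by (simp add: s_def power2_eq_square)
  finally show ?thesis .
qed

section \<open>Positivity of the numerators\<close>

definition nonneg_coeffs :: "real poly \<Rightarrow> bool" where
  "nonneg_coeffs p \<longleftrightarrow> (\<forall>i. 0 \<le> coeff p i)"

lemma nonneg_coeffs_0 [simp]: "nonneg_coeffs 0"
  by (simp add: nonneg_coeffs_def)

lemma nonneg_coeffs_pCons [simp]: "nonneg_coeffs (pCons c p) \<longleftrightarrow> 0 \<le> c \<and> nonneg_coeffs p"
  by (auto simp: nonneg_coeffs_def coeff_pCons split: nat.splits)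

lemma nonneg_coeffs_imp_poly_nonneg: "nonneg_coeffs p \<Longrightarrow> 0 \<le> v \<Longrightarrow> 0 \<le> poly p v"
  by (induction p) auto

text \<open>Subtracting 1 reduces strict positivity to a sign check of coefficients:
  \<open>poly p v \<ge> 1\<close>.\<close>

lemma nonneg_coeffs_imp_poly_pos:
  assumes "nonneg_coeffs (p - 1)" "0 \<le> v"
  shows "0 < poly p v"
  using nonneg_coeffs_imp_poly_nonneg[OF assms] by simp

text \<open>
  Numerators of the two rational inequalities for \<open>p\<close> times the first difference of the error, over the
  common denominator \<open>b * d * f * h\<close>. The fractions \<open>a / b\<close>, \<open>c / d\<close>, \<open>e / f\<close>, \<open>g / h\<close> come from
  the logarithm, the continued fraction, \<open>MC2\<close> and the error bound, respectively.
\<close>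

definition upper_num :: "'a::comm_ring_1 \<Rightarrow> 'a" where
  "upper_num s =
    (let a = 13 * log_num s * (s - 1) + 6930; b = 45045 * s^5 * (s - 1);
         c = s * cf5_num s; d = cf5_den s; e = s * mc_num s; f = mc_den s;
         g = 2048 * C2_num * (10 * s + 120 * s^2 + 252 * s^3 + 120 * s^4 + 10 * s^5);
         h = C2_den * (s - 1)^10
     in f * (h * (c * b - a * d) + g * b * d) + e * b * d * h)"

definition lower_num :: "'a::comm_ring_1 \<Rightarrow> 'a" where
  "lower_num s =
    (let a = log_num s; b = 3465 * s^5;
         c = cf6_num s; d = cf6_den s; e = s * mc_num s; f = mc_den s;
         E1 = 2 * (s + 9); E2 = s^2 + 14 * s + 81;
         g = 4096 * C2_num * s * (E1^4 - 3 * E1^2 * E2 + E2^2);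
         h = C2_den * E2^5
     in f * (h * (a * d - c * b) - g * b * d) - e * b * d * h)"



lemma poly_upper_num: "poly (upper_num q) v = upper_num (poly q v)"
  unfolding upper_num_def num_defs poly_eval by (rule refl)

lemma poly_lower_num: "poly (lower_num q) v = lower_num (poly q v)"
  unfolding lower_num_def num_defs poly_eval by (rule refl)

lemma upper_num_pos:
  fixes s :: real
  assumes "6 \<le> s"
  shows "0 < upper_num s"
proof -
  \<comment> \<open>The argument \<open>[:6, 1:]\<close> is the substitution
    \<open>s = 6 + t\<close>; evaluation at \<open>t = s - 6\<close> returns to
    \<open>s\<close>.\<close>
  have "nonneg_coeffs (upper_num [:6, 1:] - 1)"
    unfolding upper_num_def num_defs by (simp add: eval_nat_numeral numeral_poly one_pCons)
  from nonneg_coeffs_imp_poly_pos[OF this, of "s - 6"] assms show ?thesis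
    unfolding poly_upper_num by simp
qed

lemma lower_num_pos:
  fixes s :: real
  assumes "6 \<le> s"
  shows "0 < lower_num s"
proof -
  have "nonneg_coeffs (lower_num [:6, 1:] - 1)"
    unfolding lower_num_def num_defs by (simp add: eval_nat_numeral numeral_poly one_pCons)
  from nonneg_coeffs_imp_poly_pos[OF this, of "s - 6"] assms show ?thesis
    unfolding poly_lower_num by simp
qed

section \<open>The error bounds\<close>

lemma fraction_less_of_cross:
  fixes a b c d e f g h :: real
  assumes "0 < b" "0 < d" "0 < f" "0 < h"
    and "0 < f * (h * (c * b - a * d) + g * b * d) + e * b * d * h"
  shows "a / b - c / d - e / f < g / h"
proof -
  have "g / h - (a / b - c / d - e / f) = (f * (h * (c * b - a * d) + g * b * d) + e * b * d * h) / (b * d * f * h)"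
    using assms(1-4) by (simp add: divide_simps) (simp add: algebra_simps)
  also have "\<dots> > 0" using assms by simp
  finally show ?thesis by simp
qed

lemma fraction_greater_of_cross:
  fixes a b c d e f g h :: real
  assumes "0 < b" "0 < d" "0 < f" "0 < h"
    and "0 < f * (h * (a * d - c * b) - g * b * d) - e * b * d * h"
  shows "g / h < a / b - c / d - e / f"
proof -
  have "a / b - c / d - e / f - g / h = (f * (h * (a * d - c * b) - g * b * d) - e * b * d * h) / (b * d * f * h)"
    using assms(1-4) by (simp add: divide_simps) (simp add: algebra_simps)
  also have "\<dots> > 0" using assms by simp
  finally show ?thesis by simp
qed

text \<open>The factor \<open>pi\<close> clears every \<open>1 / pi\<close>, including the one in
  \<open>C2\<close>.\<close>

definition landau_error :: "nat \<Rightarrow> real" where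
  "landau_error n = pi * (G n - 1 / pi * ln (real n + 3/4) - c0 - MC2 n)"

lemma landau_error_tendsto: "landau_error \<longlonglongrightarrow> 0"
proof -
  have "MC2 \<longlonglongrightarrow> 0"
    unfolding MC2_def Let_def kappa1_def kappa2_def lambda1_def lambda2_def by real_asymp
  with G_tendsto have "landau_error \<longlonglongrightarrow> pi * (c0 - c0 - 0)"
    unfolding landau_error_def by (intro tendsto_intros)
  then show ?thesis by simp
qed

text \<open>\<open>p\<close> is the sum of \<open>n + 3/4\<close> and \<open>n + 7/4\<close>, and
  also \<open>2 * (n + 1) + 1/2\<close>, the parameter of \<open>central_ratio_bounds\<close> at
  \<open>Suc n\<close>.\<close>

lemma landau_error_diff:
  fixes n :: nat
  defines "p \<equiv> 2 * real n + 5/2"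
  shows "p * (landau_error n - landau_error (Suc n)) =
    p * ln ((p + 1) / (p - 1)) - p * (pi * central_ratio (Suc n) ^ 2) - p^2 * mc_num (p^2) / mc_den (p^2)"
proof -
  define M where "M x = kappa1 / (x + lambda1 + kappa2 / (x + lambda2))" for x
  have p: "p > 1" "(p - 1) / 2 = real n + 3/4" "(p + 1) / 2 = real (Suc n) + 3/4"
    by (simp_all add: p_def field_simps)
  have err: "landau_error m = pi * G m - ln (real m + 3/4) - pi * c0 - M ((real m + 3/4)^2)" for m
    by (simp add: landau_error_def MC2_def Let_def M_def right_diff_distrib)
  have "G (Suc n) = G n + central_ratio (Suc n) ^ 2"
    by (simp add: G_eq_sum_central_ratio)
  moreover have "ln ((p + 1) / (p - 1)) = ln ((p + 1) / 2) - ln ((p - 1) / 2)"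
    using p(1) by (simp add: ln_divide_pos)
  ultimately have "landau_error n - landau_error (Suc n) = ln ((p + 1) / (p - 1))
      - pi * central_ratio (Suc n) ^ 2 - (M (((p - 1) / 2)^2) - M (((p + 1) / 2)^2))"
    unfolding err p(2,3) by (simp add: distrib_left)
  then have "p * (landau_error n - landau_error (Suc n)) = p * ln ((p + 1) / (p - 1))
      - p * (pi * central_ratio (Suc n) ^ 2) - p * (M (((p - 1) / 2)^2) - M (((p + 1) / 2)^2))"
    by (simp add: right_diff_distrib)
  then show ?thesis
    unfolding M_def mc_difference(1)[OF p(1)] .
qed

lemma C2_eq: "pi * C2 = C2_num / C2_den"
  by (simp add: C2_def C2_num_def C2_den_def)

lemma landau_error_upper_step:
  "landau_error n - landau_error (Suc n) < pi * C2 / (real n + 3/4)^10 - pi * C2 / (real (Suc n) + 3/4)^10"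
proof -
  define p where "p = 2 * real n + 5/2"
  define s where "s = p^2"
  have p: "p > 1" "(p - 1) / 2 = real n + 3/4" "(p + 1) / 2 = real (Suc n) + 3/4"
    by (simp_all add: p_def field_simps)
  \<comment> \<open>The least value of \<open>s\<close>, at \<open>n = 0\<close>, is 25/4, just
    above 6.\<close>
  have "(5/2)^2 \<le> s" unfolding s_def by (rule power_mono) (simp_all add: p_def)
  then have s: "6 \<le> s" by (simp add: power2_eq_square)
  have p_Suc: "2 * real (Suc n) + 1/2 = p" by (simp add: p_def)
  have mc: "mc_den s > 0" unfolding s_def by (rule mc_difference(2)[OF p(1)])
  have "p * (s * cf5_num s / cf5_den s / p) < p * (pi * central_ratio (Suc n) ^ 2)"
    using central_ratio_gt[of "Suc n"] p(1) unfolding p_Suc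
    by (intro mult_strict_left_mono) (simp_all add: s_def power2_eq_square)
  with ln_ratio_le[OF p(1)] p(1)
  have "p * (landau_error n - landau_error (Suc n)) <
      (13 * log_num s * (s - 1) + 6930) / (45045 * s^5 * (s - 1)) - s * cf5_num s / cf5_den s - s * mc_num s / mc_den s"
    unfolding landau_error_diff[of n, folded p_def] s_def by simp
  also have "\<dots> < (2048 * C2_num * (10 * s + 120 * s^2 + 252 * s^3 + 120 * s^4 + 10 * s^5)) / (C2_den * (s - 1)^10)"
    using s mc upper_num_pos[OF s] cf_pos[of s]
    by (intro fraction_less_of_cross) (simp_all add: upper_num_def Let_def C2_den_def)
  also have "\<dots> = p * (pi * C2 / (real n + 3/4)^10 - pi * C2 / (real (Suc n) + 3/4)^10)"
    unfolding p(2,3)[symmetric] upper_power_difference[OF p(1)] C2_eq s_def by simp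
  finally show ?thesis using p(1) by simp
qed

lemma landau_error_lower_step:
  "pi * C2 / ((real n + 3/4)^2 + 2)^5 - pi * C2 / ((real (Suc n) + 3/4)^2 + 2)^5 < landau_error n - landau_error (Suc n)"
proof -
  define p where "p = 2 * real n + 5/2"
  define s where "s = p^2"
  have p: "p > 1" "(p - 1) / 2 = real n + 3/4" "(p + 1) / 2 = real (Suc n) + 3/4"
    by (simp_all add: p_def field_simps)
  have "(5/2)^2 \<le> s" unfolding s_def by (rule power_mono) (simp_all add: p_def)
  then have s: "6 \<le> s" by (simp add: power2_eq_square)
  have p_Suc: "2 * real (Suc n) + 1/2 = p" by (simp add: p_def)
  have mc: "mc_den s > 0" unfolding s_def by (rule mc_difference(2)[OF p(1)])
  define E1 where "E1 = 2 * (s + 9)"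
  define E2 where "E2 = s^2 + 14 * s + 81"
  have "E2 > 0" using s by (simp add: E2_def add_nonneg_pos)
  have "p * (pi * C2 / ((real n + 3/4)^2 + 2)^5 - pi * C2 / ((real (Suc n) + 3/4)^2 + 2)^5)
     = (4096 * C2_num * s * (E1^4 - 3 * E1^2 * E2 + E2^2)) / (C2_den * E2^5)"
    unfolding p(2,3)[symmetric] lower_power_difference C2_eq E1_def E2_def s_def by simp
  also have "\<dots> < log_num s / (3465 * s^5) - cf6_num s / cf6_den s - s * mc_num s / mc_den s"
    using s \<open>E2 > 0\<close> mc cf_pos[of s]
      lower_num_pos[OF s, unfolded lower_num_def Let_def, folded E1_def E2_def]
    by (intro fraction_greater_of_cross) (simp_all add: C2_den_def)
  also have "p * (pi * central_ratio (Suc n) ^ 2) < p * (cf6_num s / cf6_den s / p)"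
    using central_ratio_less[of "Suc n"] p(1) unfolding p_Suc
    by (intro mult_strict_left_mono) (simp_all add: s_def mult.commute)
  with ln_ratio_ge[OF p(1)] p(1)
  have "log_num s / (3465 * s^5) - cf6_num s / cf6_den s - s * mc_num s / mc_den s
      < p * (landau_error n - landau_error (Suc n))"
    unfolding landau_error_diff[of n, folded p_def] s_def by simp
  finally show ?thesis using p(1) by simp
qed

lemma C2_pos: "C2 > 0"
  by (simp add: C2_def)

theorem theorem2:
  fixes n :: nat
  shows "C2 / (real n + 7 / 4) ^ 10
           < G n - 1 / pi * ln (real n + 3 / 4) - c0 - MC2 n
       \<and> G n - 1 / pi * ln (real n + 3 / 4) - c0 - MC2 n
           < C2 / (real n + 3 / 4) ^ 10"
proof
  \<comment> \<open>This difference decreases strictly to 0, so it is positive.\<close>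
  have "0 < landau_error n - pi * C2 / ((real n + 3/4)^2 + 2)^5"
  proof (rule LIMSEQ_strict_decreasing_imp_less
      [where f = "\<lambda>n. landau_error n - pi * C2 / ((real n + 3/4)^2 + 2)^5"])
    have "(\<lambda>n. pi * C2 / ((real n + 3/4)^2 + 2)^5) \<longlonglongrightarrow> 0"
      by real_asymp
    from tendsto_diff[OF landau_error_tendsto this]
    show "(\<lambda>n. landau_error n - pi * C2 / ((real n + 3/4)^2 + 2)^5) \<longlonglongrightarrow> 0" by simp
    show "landau_error (Suc k) - pi * C2 / ((real (Suc k) + 3/4)^2 + 2)^5
        < landau_error k - pi * C2 / ((real k + 3/4)^2 + 2)^5" for k
      using landau_error_lower_step[of k] by linarith
  qed
  then have "pi * (C2 / ((real n + 3/4)^2 + 2)^5) < pi * (G n - 1 / pi * ln (real n + 3 / 4) - c0 - MC2 n)"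
    by (simp add: landau_error_def)
  then have "C2 / ((real n + 3/4)^2 + 2)^5 < G n - 1 / pi * ln (real n + 3 / 4) - c0 - MC2 n"
    by (simp only: mult_less_cancel_left_pos[OF pi_gt_zero])
  moreover have "C2 / (real n + 7 / 4) ^ 10 \<le> C2 / ((real n + 3/4)^2 + 2)^5"
  proof (rule divide_left_mono)
    \<comment> \<open>With \<open>y = n + 3/4\<close>, the inequality
      \<open>y^2 + 2 \<le> (y + 1)^2\<close> amounts to \<open>y \<ge> 1/2\<close>.\<close>
    have "((real n + 3/4)^2 + 2)^5 \<le> ((real n + 7/4)^2)^5"
      by (intro power_mono) (simp_all add: power2_eq_square algebra_simps)
    then show "((real n + 3/4)^2 + 2)^5 \<le> (real n + 7/4)^10"
      by (simp flip: power_mult)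
  qed (use C2_pos in \<open>auto intro!: mult_pos_pos zero_less_power add_nonneg_pos\<close>)
  ultimately show "C2 / (real n + 7 / 4) ^ 10 < G n - 1 / pi * ln (real n + 3 / 4) - c0 - MC2 n"
    by simp
next
  have "0 < pi * C2 / (real n + 3/4)^10 - landau_error n"
  proof (rule LIMSEQ_strict_decreasing_imp_less
      [where f = "\<lambda>n. pi * C2 / (real n + 3/4)^10 - landau_error n"])
    have "(\<lambda>n. pi * C2 / (real n + 3/4)^10) \<longlonglongrightarrow> 0"
      by real_asymp
    from tendsto_diff[OF this landau_error_tendsto]
    show "(\<lambda>n. pi * C2 / (real n + 3/4)^10 - landau_error n) \<longlonglongrightarrow> 0" by simp
    show "pi * C2 / (real (Suc k) + 3/4)^10 - landau_error (Suc k) < pi * C2 / (real k + 3/4)^10 - landau_error k" for k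
      using landau_error_upper_step[of k] by linarith
  qed
  then have "pi * (G n - 1 / pi * ln (real n + 3 / 4) - c0 - MC2 n) < pi * (C2 / (real n + 3 / 4) ^ 10)"
    by (simp add: landau_error_def)
  then show "G n - 1 / pi * ln (real n + 3 / 4) - c0 - MC2 n < C2 / (real n + 3 / 4) ^ 10"
    by (simp only: mult_less_cancel_left_pos[OF pi_gt_zero])
qed

end
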